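(* Let $R$ be a finite ring with identity, let $\mathcal{A}$ be a finite Frobenius $R$-$R$ bimodule, and let $\mathbf{w}$ be the homogeneous weight on $\mathcal{A}$ with average value $\gamma>0$, extended additively to $\mathcal{A}^n$. Let $K$ be an $R$-$R$ sub-bimodule of $\mathcal{A}^n$, let $M\subseteq \mathcal{A}^n$ be a union of cosets of $K$ with $\mathrm{supp}(M)=\{1,\dots,n\}$, and let $C=\{u+K: u\in M\}\subseteq \mathcal{A}^n/K$ with $|C|\ge 2$. Let $s=|\mathrm{supp}(M)|$ $(=n)$, $\ell=|\mathrm{supp}(K)|$, and $d=\min\{\mathbf{w}(u-v): u,v\in M,\ u-v\notin K\}$. Then $$(|C|-1)\,d\le (|C|\,s-\ell)\,\gamma .$$ If moreover $d>\gamma s$, then $$|C|\le \frac{d-\gamma\ell}{d-\gamma s}.$$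
   Context: For a finite ring $R$, $\hat R=\mathrm{Hom}_{\mathbb Z}(R,\mathbb C^\times)$ is the character group of $(R,+)$, an $R$-$R$ bimodule via $({}^{r}\phi)(x)=\phi(xr)$ and $(\phi^{r})(x)=\phi(rx)$. A finite $R$-$R$ bimodule $\mathcal A$ is a Frobenius bimodule if $\mathcal A\cong \hat R$ as left $R$-modules and $\mathcal A\cong\hat R$ as right $R$-modules. A weight $\mathbf w:\mathcal A\to\mathbb R$ with $\mathbf w(0)=0$ is homogeneous with average value $\gamma$ if (H1) $Rx=Ry$ implies $\mathbf w(x)=\mathbf w(y)$, and (H2) $\sum_{y\in Rx}\mathbf w(y)=\gamma|Rx|$ for every $0\ne x\in\mathcal A$. It is extended to $\mathcal A^k$ by $\mathbf w(c)=\sum_i \mathbf w(c_i)$. For $X\subseteq\mathcal A^n$, $\mathrm{supp}(X)=\{i: z_i\neq 0\text{ for some }z\in X\}$. The induced weight on $\mathcal A^n/K$ is $\hat{\mathbf w}(u+K)=\min\{\mathbf w(v): v\in u+K\}$, and $d$ is the minimum distance of $C$ with respect to $\hat{\mathbf w}$, i.e. $d=\min\{\hat{\mathbf w}(x-y):x,y\in C,\ x\ne y\}$. *)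

theory Defs
  imports Complex_Main "HOL-Analysis.Finite_Cartesian_Product"
begin

text \<open>The sort \<open>{ring, monoid_mult}\<close> is used for rings with identity, rather than \<open>ring_1\<close>,
  because the latter excludes the zero ring.\<close>

locale bimodule =
  fixes lm :: "'r::{ring,monoid_mult} \<Rightarrow> 'a::ab_group_add \<Rightarrow> 'a"
    and rm :: "'a \<Rightarrow> 'r \<Rightarrow> 'a"
  assumes lm_one: "lm 1 x = x"
    and lm_mult: "lm (r * s) x = lm r (lm s x)"
    and lm_add_left: "lm (r + s) x = lm r x + lm s x"
    and lm_add_right: "lm r (x + y) = lm r x + lm r y"
    and rm_one: "rm x 1 = x"
    and rm_mult: "rm x (r * s) = rm (rm x r) s"
    and rm_add_left: "rm (x + y) r = rm x r + rm y r"
    and rm_add_right: "rm x (r + s) = rm x r + rm x s"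
    and lm_rm: "rm (lm r x) s = lm r (rm x s)"

definition subbimodule ::
  "('r \<Rightarrow> 'b::ab_group_add \<Rightarrow> 'b) \<Rightarrow> ('b \<Rightarrow> 'r \<Rightarrow> 'b) \<Rightarrow> 'b set \<Rightarrow> bool" where
  "subbimodule lm rm K \<longleftrightarrow>
     0 \<in> K \<and> (\<forall>x\<in>K. \<forall>y\<in>K. x + y \<in> K) \<and> (\<forall>x\<in>K. - x \<in> K) \<and>
     (\<forall>r. \<forall>x\<in>K. lm r x \<in> K) \<and> (\<forall>r. \<forall>x\<in>K. rm x r \<in> K)"

definition vec_lm :: "('r \<Rightarrow> 'a \<Rightarrow> 'a) \<Rightarrow> 'r \<Rightarrow> 'a^'n \<Rightarrow> 'a^'n" where
  "vec_lm lm r v = (\<chi> i. lm r (v $ i))"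

definition vec_rm :: "('a \<Rightarrow> 'r \<Rightarrow> 'a) \<Rightarrow> 'a^'n \<Rightarrow> 'r \<Rightarrow> 'a^'n" where
  "vec_rm rm v r = (\<chi> i. rm (v $ i) r)"

lemma bimodule_vec:
  assumes "bimodule lm rm"
  shows "bimodule (vec_lm lm :: _ \<Rightarrow> 'a::ab_group_add^'n \<Rightarrow> _) (vec_rm rm)"
  using assms by (simp add: bimodule_def vec_lm_def vec_rm_def vec_eq_iff)

definition characters :: "('r::ring \<Rightarrow> complex) set" where
  "characters = {\<phi>. (\<forall>x. \<phi> x \<noteq> 0) \<and> (\<forall>x y. \<phi> (x + y) = \<phi> x * \<phi> y)}"

definition char_lm :: "'r::ring \<Rightarrow> ('r \<Rightarrow> complex) \<Rightarrow> 'r \<Rightarrow> complex" where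
  "char_lm r \<phi> = (\<lambda>x. \<phi> (x * r))"

definition char_rm :: "('r::ring \<Rightarrow> complex) \<Rightarrow> 'r \<Rightarrow> 'r \<Rightarrow> complex" where
  "char_rm \<phi> r = (\<lambda>x. \<phi> (r * x))"

text \<open>The group operation on \<open>characters\<close> is pointwise multiplication.  The left and the right
  isomorphism need not be the same map.\<close>

locale frobenius_bimodule = bimodule lm rm
  for lm :: "'r::{ring,monoid_mult,finite} \<Rightarrow> 'a::{ab_group_add,finite} \<Rightarrow> 'a"
    and rm :: "'a \<Rightarrow> 'r \<Rightarrow> 'a" +
  assumes left_iso:
    "\<exists>f. bij_betw f UNIV (characters :: ('r \<Rightarrow> complex) set) \<and>
         (\<forall>a b. f (a + b) = (\<lambda>x. f a x * f b x)) \<and>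
         (\<forall>r a. f (lm r a) = char_lm r (f a))"
    and right_iso:
    "\<exists>g. bij_betw g UNIV (characters :: ('r \<Rightarrow> complex) set) \<and>
         (\<forall>a b. g (a + b) = (\<lambda>x. g a x * g b x)) \<and>
         (\<forall>r a. g (rm a r) = char_rm (g a) r)"

definition homogeneous_weight ::
  "('r \<Rightarrow> 'a::zero \<Rightarrow> 'a) \<Rightarrow> ('a \<Rightarrow> real) \<Rightarrow> real \<Rightarrow> bool" where
  "homogeneous_weight lm w \<gamma> \<longleftrightarrow>
     w 0 = 0 \<and>
     (\<forall>x y. range (\<lambda>r. lm r x) = range (\<lambda>r. lm r y) \<longrightarrow> w x = w y) \<and>
     (\<forall>x. x \<noteq> 0 \<longrightarrow>
        (\<Sum>y\<in>range (\<lambda>r. lm r x). w y) = \<gamma> * real (card (range (\<lambda>r. lm r x))))"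

definition vec_weight :: "('a \<Rightarrow> real) \<Rightarrow> 'a^'n::finite \<Rightarrow> real" where
  "vec_weight w v = (\<Sum>i\<in>UNIV. w (v $ i))"

definition vsupp :: "('a::zero^'n) set \<Rightarrow> 'n set" where
  "vsupp X = {i. \<exists>z\<in>X. z $ i \<noteq> 0}"

definition coset :: "'b::ab_group_add \<Rightarrow> 'b set \<Rightarrow> 'b set" where
  "coset u K = (\<lambda>k. u + k) ` K"

end

theory Submission imports Defs begin

text \<open>Let \<open>\<theta> x = f x 1\<close> for the left isomorphism \<open>f\<close> of the alphabet onto the character group
  of the ring; \<open>\<theta>\<close> is a character whose kernel contains no nonzero left submodule. The homogeneous
  weight is then \<open>w x = \<gamma> (1 - avg \<theta> (t x))\<close>, the average being over the units \<open>t\<close>: the right-hand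
  side is homogeneous because \<open>Rx = Ry\<close> forces \<open>y = t x\<close> for a unit \<open>t\<close>, and homogeneous weights are
  unique. Summing \<open>w (u - v)\<close> over all pairs from \<open>M\<close> gives at most \<open>\<gamma> n |M|\<^sup>2\<close>, since
  \<open>\<Sum>\<^sub>u\<^sub>,\<^sub>v \<theta> (t (u - v)) = |\<Sum>\<^sub>u \<theta> (t u)|\<^sup>2 \<ge> 0\<close>. On the other hand, the pairs in a common coset contribute
  exactly \<open>|M| |K| \<gamma> \<ell>\<close>, by orthogonality of characters on \<open>K\<close>, and every other pair contributes at
  least \<open>d\<close>.\<close>

section \<open>Characters of finite groups\<close>

text \<open>Translating by a point of maximal norm shows that no value has norm above 1. The values
  at \<open>x\<close> and \<open>- x\<close> are inverse to each other, so neither norm can be below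
  1.\<close>

lemma norm_character_eq_1:
  fixes \<psi> :: "'a::{ab_group_add,finite} \<Rightarrow> complex"
  assumes add: "\<And>x y. \<psi> (x + y) = \<psi> x * \<psi> y" and nz: "\<And>x. \<psi> x \<noteq> 0"
  shows "norm (\<psi> x) = 1"
proof -
  define m where "m = Max (range (\<lambda>x. norm (\<psi> x)))"
  have "m \<in> range (\<lambda>x. norm (\<psi> x))"
    unfolding m_def by (rule Max_in) auto
  then obtain z where z: "m = norm (\<psi> z)" by auto
  have le: "norm (\<psi> y) \<le> 1" for y
  proof -
    have "norm (\<psi> (y + z)) \<le> norm (\<psi> z)"
      unfolding z[symmetric] m_def by (rule Max_ge) auto
    then show ?thesis
      using nz[of z] by (simp add: add norm_mult)
  qed
  have "\<psi> 0 = 1" using add[of 0 0] nz[of 0] by simp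
  then have "norm (\<psi> x) * norm (\<psi> (- x)) = 1"
    using add[of x "- x"] by (simp flip: norm_mult)
  then show ?thesis
    using le[of x] le[of "- x"] by (smt (verit) mult_left_le norm_ge_zero)
qed

lemma character_diff:
  fixes \<psi> :: "'a::{ab_group_add,finite} \<Rightarrow> complex"
  assumes add: "\<And>x y. \<psi> (x + y) = \<psi> x * \<psi> y" and nz: "\<And>x. \<psi> x \<noteq> 0"
  shows "\<psi> (x - y) = \<psi> x * cnj (\<psi> y)"
proof -
  have "\<psi> (x - y) * \<psi> y = \<psi> x" using add[of "x - y" y] by simp
  moreover have "\<psi> y * cnj (\<psi> y) = 1"
    using norm_character_eq_1[of \<psi> y] add nz by (simp flip: complex_norm_square)
  ultimately show ?thesis by (metis mult.assoc mult.right_neutral)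
qed

lemma sum_character_eq_0:
  fixes \<psi> :: "'b::ab_group_add \<Rightarrow> complex"
  assumes add: "\<And>x y. \<psi> (x + y) = \<psi> x * \<psi> y"
    and K: "\<And>x y. x \<in> K \<Longrightarrow> y \<in> K \<Longrightarrow> x + y \<in> K" "\<And>x. x \<in> K \<Longrightarrow> - x \<in> K"
    and z: "z \<in> K" "\<psi> z \<noteq> 1"
  shows "(\<Sum>x\<in>K. \<psi> x) = 0"
proof -
  have "(\<Sum>x\<in>K. \<psi> x) = (\<Sum>x\<in>K. \<psi> (z + x))"
  proof (rule sum.reindex_bij_witness[of _ "\<lambda>x. z + x" "\<lambda>x. - z + x"])
    show "- z + x \<in> K" if "x \<in> K" for x using K z(1) that by blast
  qed (use K z in auto)
  also have "\<dots> = \<psi> z * (\<Sum>x\<in>K. \<psi> x)"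
    by (simp add: add sum_distrib_left)
  finally show ?thesis using z(2) by simp
qed

text \<open>The map \<open>p\<close> from an index set lets values repeat: distinct words of a code
  may agree in a coordinate, and each pair must still be counted.\<close>

lemma sum_character_pairs_nonneg:
  fixes \<psi> :: "'a::{ab_group_add,finite} \<Rightarrow> complex"
  assumes add: "\<And>x y. \<psi> (x + y) = \<psi> x * \<psi> y" and nz: "\<And>x. \<psi> x \<noteq> 0"
  shows "(\<Sum>u\<in>T. \<Sum>v\<in>T. Re (\<psi> (p u - p v))) \<ge> 0"
proof -
  have "(\<Sum>u\<in>T. \<Sum>v\<in>T. \<psi> (p u - p v)) = (\<Sum>u\<in>T. \<psi> (p u)) * cnj (\<Sum>v\<in>T. \<psi> (p v))"
    by (simp add: character_diff[OF add nz] sum_product)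
  also have "\<dots> = of_real ((norm (\<Sum>u\<in>T. \<psi> (p u)))\<^sup>2)"
    by (simp only: complex_norm_square)
  finally have "Re (\<Sum>u\<in>T. \<Sum>v\<in>T. \<psi> (p u - p v)) = (norm (\<Sum>u\<in>T. \<psi> (p u)))\<^sup>2"
    by (simp only: Re_complex_of_real)
  then show ?thesis by simp
qed

section \<open>Finite modules with a generating character\<close>

text \<open>Left multiplication by \<open>t\<close> is injective because \<open>b\<close> undoes it,
  hence surjective by finiteness. This gives a right inverse of \<open>t\<close>, which must equal
  \<open>b\<close>.\<close>

lemma right_inverse_if_left_inverse:
  fixes t b :: "'r::{ring,monoid_mult,finite}"
  assumes "b * t = 1"
  shows "t * b = 1"
proof -
  have "inj (\<lambda>r. t * r)"
    by (rule inj_on_inverseI[of _ "\<lambda>r. b * r"]) (metis assms mult.assoc mult.left_neutral)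
  then have "surj (\<lambda>r. t * r)" by (rule finite_UNIV_inj_surj[OF finite])
  then obtain c where "t * c = 1" by (metis surjD)
  then show ?thesis by (metis assms mult.assoc mult.left_neutral mult.right_neutral)
qed

text \<open>Over a finite ring this is the full group of units. The one-sided form says directly
  that \<open>t\<close> generates the whole ring as a left ideal, which is how units are found
  below.\<close>

definition left_units :: "'r::{ring,monoid_mult} set" where
  "left_units = {t. \<exists>b. b * t = 1}"

lemma one_in_left_units: "1 \<in> left_units"
  by (auto simp: left_units_def)

lemma card_left_units_pos: "card (left_units :: 'r::{ring,monoid_mult,finite} set) > 0"
  using one_in_left_units card_gt_0_iff finite by blast

lemma bij_betw_left_units_mult:
  fixes t :: "'r::{ring,monoid_mult,finite}"
  assumes "t \<in> left_units"
  shows "bij_betw (\<lambda>r. r * t) left_units left_units"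
proof -
  obtain b where b: "b * t = 1" using assms by (auto simp: left_units_def)
  note tb = right_inverse_if_left_inverse[OF b]
  have b_unit: "b \<in> left_units" using tb by (auto simp: left_units_def)
  have closed: "r * r' \<in> left_units" if units: "r \<in> left_units" "r' \<in> left_units" for r r' :: 'r
  proof -
    obtain c c' where c: "c * r = 1" "c' * r' = 1" using units by (auto simp: left_units_def)
    have "(c' * c) * (r * r') = c' * (c * r) * r'" by (simp only: mult.assoc)
    then have "(c' * c) * (r * r') = 1" by (simp add: c)
    then show ?thesis by (auto simp: left_units_def)
  qed
  show ?thesis
    by (rule bij_betw_byWitness[of _ "\<lambda>r. r * b"])
      (auto simp: mult.assoc b tb intro: closed assms b_unit)
qed

section \<open>Unit multiples and generators of cyclic submodules\<close>

locale finite_module_with_character =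
  fixes lm :: "'r::{ring,monoid_mult,finite} \<Rightarrow> 'a::{ab_group_add,finite} \<Rightarrow> 'a"
    and \<theta> :: "'a \<Rightarrow> complex"
  assumes lm_one: "lm 1 x = x"
    and lm_mult: "lm (r * s) x = lm r (lm s x)"
    and lm_add_left: "lm (r + s) x = lm r x + lm s x"
    and lm_add_right: "lm r (x + y) = lm r x + lm r y"
    and char_add: "\<theta> (x + y) = \<theta> x * \<theta> y"
    and char_nonzero: "\<theta> x \<noteq> 0"
    and generating: "(\<And>r. \<theta> (lm r x) = 1) \<Longrightarrow> x = 0"
begin

lemma lm_diff_left: "lm (r - s) x = lm r x - lm s x"
  using lm_add_left[of "r - s" s x] by (simp add: algebra_simps)

lemma lm_zero_right: "lm r 0 = 0"
  using lm_add_right[of r 0 0] by simp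

lemma lm_zero_left: "lm 0 x = 0"
  using lm_diff_left[of 0 0 x] by simp

lemma lm_minus_left: "lm (- r) x = - lm r x"
  using lm_diff_left[of 0 r x] by (simp add: lm_zero_left)

text \<open>Both sides count the solutions \<open>t\<close> that generate a given left ideal \<open>I\<close>. For all solutions in
  \<open>I\<close> the counts agree, the solution sets being cosets of the same group or both empty; those
  generating a smaller left ideal are removed by induction.\<close>

lemma card_generators_transporting_eq:
  assumes y: "y = lm c x" and x: "x = lm e y" and I: "I = range (\<lambda>r. r * a)"
  shows "card {t. range (\<lambda>r. r * t) = I \<and> lm t x = y} =
         card {t. range (\<lambda>r. r * t) = I \<and> lm t x = x}"
  using I
proof (induction "card I" arbitrary: I a rule: less_induct)
  case less
  define T where "T z = {t \<in> I. lm t x = z}" for z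
  define P where "P J z = {t. range (\<lambda>r. r * t) = J \<and> lm t x = z}" for J z
  define \<J> where "\<J> = (\<lambda>t. range (\<lambda>r. r * t)) ` I"
  have mem: "t \<in> range (\<lambda>r. r * t)" for t :: 'r
    by (metis mult.left_neutral rangeI)
  have mult_I: "r * t \<in> I" if "t \<in> I" for r t
    using that unfolding less.prems by (auto simp flip: mult.assoc)
  have diff_I: "t - t' \<in> I" if "t \<in> I" "t' \<in> I" for t t'
    using that unfolding less.prems by (auto simp flip: left_diff_distrib)
  have add_I: "t + t' \<in> I" if "t \<in> I" "t' \<in> I" for t t'
    using that unfolding less.prems by (auto simp flip: distrib_right)
  have card_T: "card (T z) = (\<Sum>J\<in>\<J>. card (P J z))" for z
  proof -
    have "(\<Sum>J\<in>\<J>. sum (\<lambda>_. 1) {t \<in> T z. range (\<lambda>r. r * t) = J}) = sum (\<lambda>_. 1::nat) (T z)"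
      by (rule sum.group) (auto simp: \<J>_def T_def)
    moreover have "{t \<in> T z. range (\<lambda>r. r * t) = J} = P J z" if "J \<in> \<J>" for J
    proof -
      have "J \<subseteq> I" using that mult_I by (auto simp: \<J>_def)
      then show ?thesis using mem by (auto simp: T_def P_def)
    qed
    ultimately show ?thesis by simp
  qed
  have T_eq: "card (T y) = card (T x)"
  proof (cases "T y = {}")
    case True
    have "T x = {}"
    proof (rule ccontr)
      assume "T x \<noteq> {}"
      then obtain t where "t \<in> I" "lm t x = x" by (auto simp: T_def)
      then have "c * t \<in> T y" using y mult_I by (simp add: T_def lm_mult)
      then show False using True by blast
    qed
    then show ?thesis using True by simp
  next
    case False
    then obtain t where t: "t \<in> I" "lm t x = y" by (auto simp: T_def)
    \<comment> \<open>Since \<open>e\<close> sends \<open>y\<close> back to \<open>x\<close>,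
      subtracting \<open>e * t\<close> makes \<open>q\<close> send \<open>x\<close> to
      \<open>y - x\<close> while staying in the left ideal \<open>I\<close>. Adding \<open>q\<close>
      therefore turns solutions for \<open>x\<close> into solutions for \<open>y\<close>.\<close>
    define q where "q = t - e * t"
    have q: "q \<in> I" "lm q x = y - x"
      using t x mult_I diff_I by (simp_all add: q_def lm_mult lm_diff_left)
    have "bij_betw (\<lambda>r. r + q) (T x) (T y)"
      by (rule bij_betw_byWitness[of _ "\<lambda>r. r - q"])
        (auto simp: T_def lm_add_left lm_diff_left q intro: add_I diff_I)
    then show ?thesis by (simp add: bij_betw_same_card)
  qed
  have I_in: "I \<in> \<J>"
    unfolding \<J>_def using less.prems mem[of a] by blast
  have "card (P J y) = card (P J x)" if J: "J \<in> \<J> - {I}" for J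
  proof -
    obtain t where t: "t \<in> I" "J = range (\<lambda>r. r * t)" using J by (auto simp: \<J>_def)
    then have "J \<subset> I" using J mult_I by auto
    then show ?thesis
      unfolding P_def using less.hyps[OF _ t(2)] by (simp add: psubset_card_mono)
  qed
  then have "(\<Sum>J\<in>\<J> - {I}. card (P J y)) = (\<Sum>J\<in>\<J> - {I}. card (P J x))"
    by (rule sum.cong[OF refl])
  moreover have "card (T z) = card (P I z) + (\<Sum>J\<in>\<J> - {I}. card (P J z))" for z
    unfolding card_T by (rule sum.remove) (use I_in in auto)
  ultimately have "card (P I y) = card (P I x)" using T_eq by simp
  then show ?case by (simp add: P_def)
qed

text \<open>Take the whole ring as the left ideal in the counting lemma: 1 is a solution of
  \<open>lm t x = x\<close>, so the equal count for \<open>lm t x = y\<close> is positive. A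
  solution that generates the ring is a unit.\<close>

lemma left_unit_between_generators:
  assumes "range (\<lambda>r. lm r x) = range (\<lambda>r. lm r y)"
  obtains t where "t \<in> left_units" "lm t x = y"
proof -
  have "x \<in> range (\<lambda>r. lm r x)" "y \<in> range (\<lambda>r. lm r y)"
    by (metis lm_one rangeI)+
  then have "y \<in> range (\<lambda>r. lm r x)" "x \<in> range (\<lambda>r. lm r y)" using assms by simp_all
  then obtain c e where ce: "y = lm c x" "x = lm e y" by blast
  have "card {t. range (\<lambda>r. r * t) = UNIV \<and> lm t x = y} =
        card {t. range (\<lambda>r. r * t) = UNIV \<and> lm t x = x}"
    by (rule card_generators_transporting_eq[OF ce, of _ 1]) simp
  moreover have "1 \<in> {t. range (\<lambda>r. r * t) = UNIV \<and> lm t x = x}"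
    by (simp add: lm_one)
  ultimately have "{t. range (\<lambda>r. r * t) = UNIV \<and> lm t x = y} \<noteq> {}"
    by (metis (no_types, lifting) card_eq_0_iff empty_iff finite)
  then obtain t where t: "range (\<lambda>r. r * t) = UNIV" "lm t x = y" by auto
  then have "t \<in> left_units" by (auto simp: left_units_def) (metis surjD)
  then show thesis using t(2) that by blast
qed

section \<open>Averages of the generating character over the units\<close>

definition unit_average :: "'a \<Rightarrow> real" where
  "unit_average x = (\<Sum>t\<in>left_units. Re (\<theta> (lm t x))) / card (left_units :: 'r set)"

lemma unit_average_zero: "unit_average 0 = 1"
proof -
  have "\<theta> 0 = 1" using char_add[of 0 0] char_nonzero[of 0] by simp
  then show ?thesis
    using card_left_units_pos[where 'r = 'r]
    by (simp add: unit_average_def lm_zero_right card_gt_0_iff)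
qed

text \<open>The two generators differ by a unit, and right multiplication by that unit permutes the
  units in the average.\<close>

lemma unit_average_cong:
  assumes "range (\<lambda>r. lm r x) = range (\<lambda>r. lm r y)"
  shows "unit_average x = unit_average y"
proof -
  obtain t where t: "t \<in> left_units" "lm t x = y"
    using left_unit_between_generators[OF assms] .
  have "(\<Sum>s\<in>left_units. Re (\<theta> (lm (s * t) x))) = (\<Sum>s\<in>left_units. Re (\<theta> (lm s x)))"
    by (rule sum.reindex_bij_betw[OF bij_betw_left_units_mult[OF t(1)]])
  then show ?thesis by (simp add: unit_average_def lm_mult t(2))
qed

text \<open>For each unit \<open>t\<close>, the character \<open>\<theta> (lm t (p x))\<close> of
  \<open>x\<close> is nontrivial on \<open>K\<close>, so its sum vanishes. Here \<open>p\<close>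
  will be the identity on a cyclic submodule or a coordinate projection on a code.\<close>

lemma sum_unit_average_eq_0:
  fixes p :: "'b::ab_group_add \<Rightarrow> 'a"
  assumes p: "\<And>x y. p (x + y) = p x + p y"
    and K: "\<And>x y. x \<in> K \<Longrightarrow> y \<in> K \<Longrightarrow> x + y \<in> K" "\<And>x. x \<in> K \<Longrightarrow> - x \<in> K"
    and lm: "\<And>r x. x \<in> K \<Longrightarrow> lm r (p x) \<in> p ` K"
    and z: "z \<in> K" "p z \<noteq> 0"
  shows "(\<Sum>x\<in>K. unit_average (p x)) = 0"
proof -
  have "(\<Sum>x\<in>K. \<theta> (lm t (p x))) = 0" if t: "t \<in> left_units" for t
  proof -
    obtain b where "b * t = 1" using t by (auto simp: left_units_def)
    then have tb: "t * b = 1" by (rule right_inverse_if_left_inverse)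
    obtain r where r: "\<theta> (lm r (p z)) \<noteq> 1" using generating z(2) by blast
    \<comment> \<open>The factor \<open>b\<close>, inverse to \<open>t\<close>, is inserted so that
      applying \<open>t\<close> to \<open>p z'\<close> leaves \<open>lm r (p z)\<close>, where
      \<open>\<theta>\<close> is not 1.\<close>
    obtain z' where z': "z' \<in> K" "p z' = lm (b * r) (p z)" using lm[OF z(1), of "b * r"] by auto
    have "lm t (p z') = lm r (p z)"
      by (metis z'(2) lm_mult mult.assoc tb mult.left_neutral)
    then show ?thesis
      using r by (intro sum_character_eq_0[of "\<lambda>x. \<theta> (lm t (p x))" K z'])
        (auto simp: p lm_add_right char_add K z')
  qed
  then have "(\<Sum>t\<in>left_units. \<Sum>x\<in>K. Re (\<theta> (lm t (p x)))) = 0"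
    unfolding Re_sum[symmetric] by simp
  then have "(\<Sum>x\<in>K. \<Sum>t\<in>left_units. Re (\<theta> (lm t (p x)))) = 0"
    by (subst sum.swap)
  then show ?thesis by (simp add: unit_average_def flip: sum_divide_distrib)
qed

lemma sum_unit_average_pairs_nonneg:
  "(\<Sum>u\<in>T. \<Sum>v\<in>T. unit_average (p u - p v)) \<ge> 0"
proof -
  have "(\<Sum>u\<in>T. \<Sum>v\<in>T. \<Sum>t\<in>left_units. Re (\<theta> (lm t (p u - p v)))) =
      (\<Sum>u\<in>T. \<Sum>t\<in>left_units. \<Sum>v\<in>T. Re (\<theta> (lm t (p u - p v))))"
    by (rule sum.cong[OF refl]) (rule sum.swap)
  also have "\<dots> = (\<Sum>t\<in>left_units. \<Sum>u\<in>T. \<Sum>v\<in>T. Re (\<theta> (lm t (p u - p v))))"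
    by (rule sum.swap)
  also have "\<dots> \<ge> 0"
    by (intro sum_nonneg sum_character_pairs_nonneg) (simp_all add: lm_add_right char_add char_nonzero)
  finally show ?thesis by (simp add: unit_average_def flip: sum_divide_distrib)
qed

section \<open>Uniqueness and character formula of the homogeneous weight\<close>

text \<open>Gives uniqueness of homogeneous weights when \<open>h\<close> is a difference of two. In
  the sum over the submodule generated by \<open>x\<close>, non-generators vanish by induction on
  its size, and all generators contribute the same value \<open>h x\<close>.\<close>

lemma eq_0_if_sums_over_cyclic_eq_0:
  fixes h :: "'a \<Rightarrow> real"
  assumes cong: "\<And>x y. range (\<lambda>r. lm r x) = range (\<lambda>r. lm r y) \<Longrightarrow> h x = h y"
    and sum: "\<And>x. (\<Sum>y\<in>range (\<lambda>r. lm r x). h y) = 0"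
  shows "h x = 0"
proof (induction "card (range (\<lambda>r. lm r x))" arbitrary: x rule: less_induct)
  case less
  define B where "B = range (\<lambda>r. lm r x)"
  define G where "G = {y \<in> B. range (\<lambda>r. lm r y) = B}"
  have "h y = 0" if "y \<in> B - G" for y
  proof (rule less)
    have "range (\<lambda>r. lm r y) \<subset> B"
      using that unfolding G_def B_def by (auto simp flip: lm_mult)
    then show "card (range (\<lambda>r. lm r y)) < card (range (\<lambda>r. lm r x))"
      unfolding B_def by (simp add: psubset_card_mono)
  qed
  then have "(\<Sum>y\<in>G. h y) = (\<Sum>y\<in>B. h y)"
    by (intro sum.mono_neutral_left) (auto simp: G_def)
  also have "\<dots> = 0" unfolding B_def by (rule sum)
  finally have "(\<Sum>y\<in>G. h y) = 0" .
  moreover have "(\<Sum>y\<in>G. h y) = (\<Sum>y\<in>G. h x)"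
    by (intro sum.cong refl cong) (simp add: G_def B_def)
  moreover have "x \<in> G"
    unfolding G_def B_def by simp (metis lm_one rangeI)
  ultimately show ?case by auto
qed

lemma homogeneous_weight_eq:
  assumes "homogeneous_weight lm w \<gamma>"
  shows "w x = \<gamma> * (1 - unit_average x)"
proof -
  have w: "w 0 = 0" "\<And>x y. range (\<lambda>r. lm r x) = range (\<lambda>r. lm r y) \<Longrightarrow> w x = w y"
    "\<And>x. x \<noteq> 0 \<Longrightarrow> (\<Sum>y\<in>range (\<lambda>r. lm r x). w y) = \<gamma> * card (range (\<lambda>r. lm r x))"
    using assms unfolding homogeneous_weight_def by blast+
  have "w x - \<gamma> * (1 - unit_average x) = 0"
  proof (rule eq_0_if_sums_over_cyclic_eq_0)
    show "w x - \<gamma> * (1 - unit_average x) = w y - \<gamma> * (1 - unit_average y)"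
      if "range (\<lambda>r. lm r x) = range (\<lambda>r. lm r y)" for x y
      using w(2)[OF that] unit_average_cong[OF that] by simp
    show "(\<Sum>y\<in>range (\<lambda>r. lm r x). w y - \<gamma> * (1 - unit_average y)) = 0" for x
    proof (cases "x = 0")
      case True
      \<comment> \<open>The averaging condition says nothing about 0; here the sum is a single term,
        and it vanishes because \<open>unit_average 0 = 1\<close> matches
        \<open>w 0 = 0\<close>.\<close>
      then have "range (\<lambda>r. lm r x) = {0}" by (auto simp: lm_zero_right)
      then show ?thesis by (simp add: w(1) unit_average_zero)
    next
      case False
      have "(\<Sum>y\<in>range (\<lambda>r. lm r x). unit_average y) = 0"
      proof (rule sum_unit_average_eq_0[where p = "\<lambda>y. y" and z = x])
        show "x \<in> range (\<lambda>r. lm r x)" by (metis lm_one rangeI)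
      qed (use False in \<open>auto simp flip: lm_add_left lm_minus_left lm_mult\<close>)
      then show ?thesis
        by (simp add: sum_subtractf w(3)[OF False] flip: sum_distrib_left)
    qed
  qed
  then show ?thesis by simp
qed

section \<open>Weight sums over pairs of words and over submodules\<close>

lemma sum_homogeneous_weight_pairs_le:
  assumes "homogeneous_weight lm w \<gamma>" "\<gamma> \<ge> 0"
  shows "(\<Sum>u\<in>T. \<Sum>v\<in>T. w (p u - p v)) \<le> \<gamma> * (real (card T))\<^sup>2"
proof -
  have "(\<Sum>u\<in>T. \<Sum>v\<in>T. w (p u - p v)) =
      \<gamma> * (real (card T))\<^sup>2 - \<gamma> * (\<Sum>u\<in>T. \<Sum>v\<in>T. unit_average (p u - p v))"
    by (simp add: homogeneous_weight_eq[OF assms(1)] sum_subtractf power2_eq_square algebra_simps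
        flip: sum_distrib_left)
  then show ?thesis
    using assms(2) sum_unit_average_pairs_nonneg[where p = p and T = T] by simp
qed

text \<open>On a coordinate in the support the unit averages cancel over \<open>K\<close>, leaving
  the constant \<gamma> for each word; off the support every term is \<open>w 0\<close>.\<close>

lemma sum_homogeneous_weight_coordinate:
  fixes K :: "('a^'n::finite) set"
  assumes w: "homogeneous_weight lm w \<gamma>" and K: "subbimodule (vec_lm lm) rm K"
  shows "(\<Sum>k\<in>K. w (k $ i)) = (if i \<in> vsupp K then \<gamma> * card K else 0)"
proof (cases "i \<in> vsupp K")
  case True
  then obtain z where z: "z \<in> K" "z $ i \<noteq> 0" by (auto simp: vsupp_def)
  have "(\<Sum>k\<in>K. unit_average (k $ i)) = 0"
  proof (rule sum_unit_average_eq_0[where p = "\<lambda>k. k $ i" and z = z])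
    show "lm r (k $ i) \<in> (\<lambda>k. k $ i) ` K" if "k \<in> K" for r k
    proof (rule image_eqI)
      show "vec_lm lm r k \<in> K" using K that by (simp add: subbimodule_def)
    qed (simp add: vec_lm_def)
  qed (use K z in \<open>auto simp: subbimodule_def\<close>)
  then show ?thesis
    using True by (simp add: homogeneous_weight_eq[OF w] sum_subtractf flip: sum_distrib_left)
next
  case False
  then have "(\<Sum>k\<in>K. w (k $ i)) = (\<Sum>k\<in>K. w 0)"
    by (intro sum.cong) (auto simp: vsupp_def)
  moreover have "w 0 = 0" using w unfolding homogeneous_weight_def by blast
  ultimately show ?thesis using False by simp
qed

lemma sum_vec_weight_submodule:
  fixes K :: "('a^'n::finite) set"
  assumes "homogeneous_weight lm w \<gamma>" "subbimodule (vec_lm lm) rm K"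
  shows "(\<Sum>k\<in>K. vec_weight w k) = \<gamma> * card K * card (vsupp K)"
proof -
  have "(\<Sum>k\<in>K. vec_weight w k) = (\<Sum>i\<in>UNIV. \<Sum>k\<in>K. w (k $ i))"
    unfolding vec_weight_def by (rule sum.swap)
  also have "\<dots> = (\<Sum>i\<in>vsupp K. \<gamma> * card K)"
    by (simp add: sum_homogeneous_weight_coordinate[OF assms] sum.If_cases)
  finally show ?thesis by simp
qed

lemma sum_vec_weight_pairs_le:
  fixes M :: "('a^'n::finite) set"
  assumes "homogeneous_weight lm w \<gamma>" "\<gamma> \<ge> 0"
  shows "(\<Sum>u\<in>M. \<Sum>v\<in>M. vec_weight w (u - v)) \<le> CARD('n) * (\<gamma> * (real (card M))\<^sup>2)"
proof -
  have "(\<Sum>u\<in>M. \<Sum>v\<in>M. vec_weight w (u - v)) =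
      (\<Sum>u\<in>M. \<Sum>i\<in>UNIV. \<Sum>v\<in>M. w (u $ i - v $ i))"
    unfolding vec_weight_def by (rule sum.cong[OF refl], subst sum.swap) simp
  also have "\<dots> = (\<Sum>i\<in>UNIV. \<Sum>u\<in>M. \<Sum>v\<in>M. w (u $ i - v $ i))"
    by (rule sum.swap)
  also have "\<dots> \<le> (\<Sum>i\<in>(UNIV::'n set). \<gamma> * (real (card M))\<^sup>2)"
    by (intro sum_mono sum_homogeneous_weight_pairs_le[OF assms])
  finally show ?thesis by simp
qed

end

text \<open>Evaluating at 1 turns \<open>f (lm r x)\<close> into \<open>f x r\<close>. Hence if
  \<open>\<theta>\<close> is trivial on all multiples of \<open>x\<close>, then \<open>f x\<close>
  is the trivial character \<open>f 0\<close>, and injectivity of \<open>f\<close> gives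
  \<open>x = 0\<close>.\<close>

lemma (in frobenius_bimodule) generating_character_exists:
  "\<exists>\<theta>. finite_module_with_character lm \<theta>"
proof -
  obtain f where bij: "bij_betw f UNIV (characters :: ('r \<Rightarrow> complex) set)"
    and f_add: "\<And>a b. f (a + b) = (\<lambda>x. f a x * f b x)"
    and f_lm: "\<And>r a. f (lm r a) = char_lm r (f a)"
    using left_iso by blast
  have "f a \<in> characters" for a using bij by (auto simp: bij_betw_def)
  then have nz: "f a x \<noteq> 0" for a x by (auto simp: characters_def)
  have f_0: "f 0 = (\<lambda>_. 1)"
  proof
    show "f 0 x = 1" for x using fun_cong[OF f_add[of 0 0], of x] nz[of 0 x] by simp
  qed
  have "finite_module_with_character lm (\<lambda>a. f a 1)"
  proof (unfold_locales; (rule lm_one lm_mult lm_add_left lm_add_right nz)?)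
    show "f (x + y) 1 = f x 1 * f y 1" for x y by (simp add: f_add)
    show "x = 0" if "\<And>r. f (lm r x) 1 = 1" for x
    proof -
      have "f x = f 0" using that by (simp add: f_lm char_lm_def f_0 fun_eq_iff)
      then show ?thesis using bij by (auto simp: bij_betw_def dest: injD)
    qed
  qed
  then show ?thesis by blast
qed

section \<open>Unions of cosets\<close>

lemma mem_coset_iff: "v \<in> coset u K \<longleftrightarrow> v - u \<in> K"
proof
  assume "v - u \<in> K"
  then have "u + (v - u) \<in> coset u K" unfolding coset_def by (rule imageI)
  then show "v \<in> coset u K" by simp
qed (auto simp: coset_def)

lemma card_coset: "card (coset u K) = card K"
  by (simp add: coset_def card_image)

lemma coset_eq_if_mem:
  assumes "\<And>x y. x \<in> K \<Longrightarrow> y \<in> K \<Longrightarrow> x + y \<in> K" "\<And>x. x \<in> K \<Longrightarrow> - x \<in> K" "v \<in> coset u K"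
  shows "coset v K = coset u K"
proof -
  have vu: "v - u \<in> K" "u - v \<in> K"
    using assms(2)[of "v - u"] assms(3) by (simp_all add: mem_coset_iff)
  have "z - v \<in> K \<longleftrightarrow> z - u \<in> K" for z
    using assms(1)[OF _ vu(1), of "z - v"] assms(1)[OF _ vu(2), of "z - u"] by auto
  then show ?thesis by (auto simp: mem_coset_iff)
qed

lemma card_union_of_cosets:
  fixes K M :: "'b::{ab_group_add,finite} set"
  assumes K: "0 \<in> K" "\<And>x y. x \<in> K \<Longrightarrow> y \<in> K \<Longrightarrow> x + y \<in> K" "\<And>x. x \<in> K \<Longrightarrow> - x \<in> K"
    and M: "\<And>u. u \<in> M \<Longrightarrow> coset u K \<subseteq> M"
  shows "card M = card {coset u K | u. u \<in> M} * card K"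
proof -
  let ?C = "{coset u K | u. u \<in> M}"
  have "\<Union>?C = M" using M K(1) by (force simp: mem_coset_iff)
  moreover have "card K * card ?C = card (\<Union>?C)"
  proof (rule card_partition)
    show "c \<inter> c' = {}" if "c \<in> ?C" "c' \<in> ?C" "c \<noteq> c'" for c c'
      using that coset_eq_if_mem[OF K(2,3)] by blast
  qed (auto simp: card_coset)
  ultimately show ?thesis by (simp add: mult.commute)
qed

text \<open>With \<open>u\<close> fixed, \<open>u - v\<close> runs exactly once through
  \<open>K\<close> as \<open>v\<close> runs through the coset of \<open>u\<close>. Each of the
  remaining \<open>card M - card K\<close> words contributes at least \<open>d\<close>.\<close>

lemma sum_pairs_union_of_cosets_ge:
  fixes K M :: "'b::{ab_group_add,finite} set" and W :: "'b \<Rightarrow> real"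
  assumes K: "\<And>x. x \<in> K \<Longrightarrow> - x \<in> K"
    and M: "\<And>u. u \<in> M \<Longrightarrow> coset u K \<subseteq> M"
    and d: "\<And>u v. u \<in> M \<Longrightarrow> v \<in> M \<Longrightarrow> u - v \<notin> K \<Longrightarrow> d \<le> W (u - v)"
  shows "(\<Sum>u\<in>M. \<Sum>v\<in>M. W (u - v)) \<ge>
    card M * ((\<Sum>k\<in>K. W k) + (real (card M) - card K) * d)"
proof -
  have "(\<Sum>v\<in>M. W (u - v)) \<ge> (\<Sum>k\<in>K. W k) + (real (card M) - card K) * d" if u: "u \<in> M" for u
  proof -
    have sub: "coset u K \<subseteq> M" using M u .
    have "(\<Sum>v\<in>coset u K. W (u - v)) = (\<Sum>k\<in>K. W k)"
      by (rule sum.reindex_bij_witness[of _ "\<lambda>k. u - k" "\<lambda>v. u - v"])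
        (use K in \<open>auto simp: mem_coset_iff dest: K\<close>)
    moreover have "(\<Sum>v\<in>M - coset u K. W (u - v)) \<ge> (\<Sum>v\<in>M - coset u K. d)"
    proof (intro sum_mono d[OF u])
      show "u - v \<notin> K" if "v \<in> M - coset u K" for v
        using that K[of "u - v"] by (auto simp: mem_coset_iff)
    qed auto
    moreover have "real (card (M - coset u K)) = real (card M) - card K"
      using card_mono[OF _ sub] by (simp add: card_Diff_subset sub card_coset)
    ultimately show ?thesis
      using sum.subset_diff[OF sub, of "\<lambda>v. W (u - v)"] by simp
  qed
  then have "(\<Sum>u\<in>M. (\<Sum>k\<in>K. W k) + (real (card M) - card K) * d) \<le> (\<Sum>u\<in>M. \<Sum>v\<in>M. W (u - v))"
    by (rule sum_mono)
  then show ?thesis by simp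
qed

theorem mainTheorem1:
  fixes lm :: "'r::{ring,monoid_mult,finite} \<Rightarrow> 'a::{ab_group_add,finite} \<Rightarrow> 'a"
    and rm :: "'a \<Rightarrow> 'r \<Rightarrow> 'a"
    and w :: "'a \<Rightarrow> real" and \<gamma> d :: real
    and K M :: "('a^'n::finite) set"
    and C :: "('a^'n) set set"
    and s l :: nat
  assumes "frobenius_bimodule lm rm"
    and "\<gamma> > 0"
    and "homogeneous_weight lm w \<gamma>"
    and "subbimodule (vec_lm lm) (vec_rm rm) K"
    and "\<exists>U. M = (\<Union>u\<in>U. coset u K)"
    and "vsupp M = UNIV"
    and "C = {coset u K | u. u \<in> M}"
    and "card C \<ge> 2"
    and "s = card (vsupp M)"
    and "l = card (vsupp K)"
    and "d = Min {vec_weight w (u - v) | u v. u \<in> M \<and> v \<in> M \<and> u - v \<notin> K}"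
  shows "(real (card C) - 1) * d \<le> (real (card C) * real s - real l) * \<gamma> \<and>
         (d > \<gamma> * real s \<longrightarrow>
            real (card C) \<le> (d - \<gamma> * real l) / (d - \<gamma> * real s))"
proof -
  obtain \<theta> where "finite_module_with_character lm \<theta>"
    using frobenius_bimodule.generating_character_exists[OF assms(1)] by blast
  then interpret finite_module_with_character lm \<theta> .
  have K: "0 \<in> K" "\<And>x y. x \<in> K \<Longrightarrow> y \<in> K \<Longrightarrow> x + y \<in> K" "\<And>x. x \<in> K \<Longrightarrow> - x \<in> K"
    using assms(4) by (auto simp: subbimodule_def)
  obtain U where U: "M = (\<Union>u\<in>U. coset u K)" using assms(5) by blast
  have M: "coset u K \<subseteq> M" if "u \<in> M" for u
    using that coset_eq_if_mem[OF K(2,3)] unfolding U by blast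
  have d_le: "d \<le> vec_weight w (u - v)" if "u \<in> M" "v \<in> M" "u - v \<notin> K" for u v
    unfolding assms(11)
  proof (rule Min_le)
    show "finite {vec_weight w (u - v) | u v. u \<in> M \<and> v \<in> M \<and> u - v \<notin> K}"
      by (rule finite_subset[of _ "range (vec_weight w)"]) auto
  qed (use that in blast)
  define N k where "N = real (card C)" and "k = real (card K)"
  have M_card: "real (card M) = N * k"
    using card_union_of_cosets[OF K M] assms(7) by (simp add: N_def k_def)
  have s: "s = CARD('n)" using assms(6,9) by simp
  have k: "k > 0" using K(1) by (auto simp: k_def card_gt_0_iff)
  have N: "N > 0" using assms(8) by (simp add: N_def)
  \<comment> \<open>The lower and the upper bound for the sum over all pairs, with
    \<open>N * k\<close> words in \<open>M\<close>; the common positive factor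
    \<open>N * k * k\<close> is then cancelled.\<close>
  have "N * k * (\<gamma> * k * l + (N * k - k) * d) \<le> s * (\<gamma> * (N * k)\<^sup>2)"
    using sum_pairs_union_of_cosets_ge[of K M d "vec_weight w", OF K(3) M d_le]
      sum_vec_weight_pairs_le[OF assms(3), of M] assms(2)
    by (simp add: sum_vec_weight_submodule[OF assms(3,4)] M_card s assms(10) flip: k_def)
  then have "(N * k * k) * (\<gamma> * l + (N - 1) * d) \<le> (N * k * k) * (s * \<gamma> * N)"
    by (simp add: power2_eq_square algebra_simps)
  then have "\<gamma> * l + (N - 1) * d \<le> s * \<gamma> * N"
    using N k by simp
  then have first: "(N - 1) * d \<le> (N * s - l) * \<gamma>"
    by (simp add: algebra_simps)
  \<comment> \<open>The first bound rearranges to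
    \<open>N * (d - \<gamma> * s) \<le> d - \<gamma> * l\<close>, and the factor of \<open>N\<close>
    is now positive.\<close>
  moreover have "N \<le> (d - \<gamma> * l) / (d - \<gamma> * s)" if "d > \<gamma> * s"
    using first that by (simp add: le_divide_eq algebra_simps)
  ultimately show ?thesis by (simp add: N_def)
qed

end
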